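(* Let $q\in\mathbb C^*$ with $q^2\ne1$, and let $((a_{i,j}),(b_{i,j}))\in\Gamma_n^z$. Then, for suitable choice of the representatives of the two projective points, one of the following holds: (1) the matrix $(a_{i,j})$ has rank one and $b_{i,j}=a_{i,j}$ for all $i,j$; or (2) $(a_{i,j})$ is of the block diagonal form $(a_{i,j})=\mathrm{diag}(0,\dots,0,D_1,0,\dots,0,D_2,0,\dots,0)$, where $D_1,D_2$ are rank one matrices (of arbitrary shape), and $(b_{i,j})=\mathrm{diag}(0,\dots,0,T_1,0,\dots,0,T_2,0,\dots,0)$ with the same block positions, where $T_1=D_1$ and $T_2=q^{-2}D_2$.
   Context: $J^z_q(n)$ is the quadratic algebra with generators $M_{i,j}$, $1\le i,j\le n$, and relations $M_{i,j}M_{s,t}=M_{s,t}M_{i,j}$ if $(s-i)(t-j)\le0$, and $qM_{i,j}M_{s,t}=q^{-1}M_{s,t}M_{i,j}+(q-q^{-1})M_{i,t}M_{s,j}$ if $i<s$ and $j<t$. For a quadratic algebra $T(V)/(R)$, $R\subset V\otimes V$, with basis $(x_k)$ of $V$, an element $f=\sum\alpha_{k,l}x_k\otimes x_l$ defines $f(p,p')=\sum\alpha_{k,l}x_k(p)x_l(p')$ for $p,p'\in V^*$, and the associated variety is $\Gamma(R)=\{(p,p')\in\mathbb P(V^* )\times\mathbb P(V^* ): f(p,p')=0\ \forall f\in R\}$. Here $V$ has basis $M_{i,j}$ and points of $\mathbb P(V^* )$ are represented by nonzero complex $n\times n$ matrices up to scalars; $\Gamma_n^z$ is the associated variety of $J_q^z(n)$.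 Thus $((a_{i,j}),(b_{i,j}))\in\Gamma_n^z$ means that the relations hold with each product $M_{i,j}M_{s,t}$ replaced by $a_{i,j}b_{s,t}$. In a block diagonal form $\mathrm{diag}(0,\dots,0,D_1,0,\dots,0,D_2,0,\dots,0)$ blocks may be rectangular: $D_1$ occupies an interval of rows and an interval of columns, and $D_2$ occupies an interval of rows strictly below those of $D_1$ and an interval of columns strictly to the right of those of $D_1$; all other entries vanish. *)

theory Defs
  imports
    "HOL-Library.Poly_Mapping"
    "Jordan_Normal_Form.DL_Rank"
begin

text \<open>
  For a complex vector space V with finite basis \<open>(x\<^sub>k)\<close>, \<open>k \<in> I\<close>, an element
  \<open>\<Sum>\<alpha>\<^sub>k\<^sub>l x\<^sub>k \<otimes> x\<^sub>l\<close> of \<open>V \<otimes> V\<close> is its coefficient family \<open>(k, l) \<mapsto> \<alpha>\<^sub>k\<^sub>l\<close>.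
\<close>

type_synonym 'k tensor2 = "('k \<times> 'k) \<Rightarrow>\<^sub>0 complex"

definition tscale :: "complex \<Rightarrow> 'k tensor2 \<Rightarrow> 'k tensor2" where
  "tscale c f = Poly_Mapping.map ((*) c) f"

lemma lookup_tscale [simp]: "Poly_Mapping.lookup (tscale c f) x = c * Poly_Mapping.lookup f x"
  by (simp add: tscale_def Poly_Mapping.map.rep_eq when_def)

global_interpretation tensor2: vector_space "tscale :: complex \<Rightarrow> 'k tensor2 \<Rightarrow> 'k tensor2"
  by standard (auto intro!: poly_mapping_eqI simp: lookup_add algebra_simps)

definition tens :: "'k \<Rightarrow> 'k \<Rightarrow> 'k tensor2" where
  "tens k l = Poly_Mapping.single (k, l) 1"

text \<open>
  A quadratic algebra \<open>T(V)/(R)\<close> is given by the index set of a basis of V and the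
  subspace R of \<open>V \<otimes> V\<close>.
\<close>

type_synonym 'k quadratic_algebra = "'k set \<times> 'k tensor2 set"

text \<open>An element p of \<open>V\<^sup>*\<close> is given by its coordinates \<open>k \<mapsto> x\<^sub>k(p)\<close>.\<close>

definition dual_space :: "'k set \<Rightarrow> ('k \<Rightarrow> complex) set" where
  "dual_space I = {p. \<forall>k. k \<notin> I \<longrightarrow> p k = 0}"

definition proj_class :: "('k \<Rightarrow> complex) \<Rightarrow> ('k \<Rightarrow> complex) set" where
  "proj_class p = {(\<lambda>k. c * p k) | c. c \<noteq> 0}"

definition proj_space :: "'k set \<Rightarrow> ('k \<Rightarrow> complex) set set" where
  "proj_space I = {proj_class p | p. p \<in> dual_space I \<and> p \<noteq> (\<lambda>k. 0)}"

definition tensor_eval :: "'k tensor2 \<Rightarrow> ('k \<Rightarrow> complex) \<Rightarrow> ('k \<Rightarrow> complex) \<Rightarrow> complex" where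
  "tensor_eval f p p' = (\<Sum>(k, l)\<in>Poly_Mapping.keys f. Poly_Mapping.lookup f (k, l) * p k * p' l)"

definition associated_variety ::
    "'k quadratic_algebra \<Rightarrow> (('k \<Rightarrow> complex) set \<times> ('k \<Rightarrow> complex) set) set" where
  "associated_variety A =
     {(x, y). x \<in> proj_space (fst A) \<and> y \<in> proj_space (fst A) \<and>
        (\<forall>f\<in>snd A. \<forall>p\<in>x. \<forall>p'\<in>y. tensor_eval f p p' = 0)}"

text \<open>
  Row and column indices run over \<open>0, \<dots>, n - 1\<close> instead of \<open>1, \<dots>, n\<close>.  The generator
  \<open>M\<^sub>i\<^sub>j\<close> is the basis vector with index \<open>(i, j)\<close>.
\<close>

definition Jz_generators :: "nat \<Rightarrow> (nat \<times> nat) set" where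
  "Jz_generators n = {..<n} \<times> {..<n}"

definition Jz_relations :: "complex \<Rightarrow> nat \<Rightarrow> (nat \<times> nat) tensor2 set" where
  "Jz_relations q n =
     {tens (i, j) (s, t) - tens (s, t) (i, j) | i j s t.
        i < n \<and> j < n \<and> s < n \<and> t < n \<and> (int s - int i) * (int t - int j) \<le> 0} \<union>
     {tscale q (tens (i, j) (s, t))
        - (tscale (inverse q) (tens (s, t) (i, j))
           + tscale (q - inverse q) (tens (i, t) (s, j))) | i j s t.
        i < n \<and> j < n \<and> s < n \<and> t < n \<and> i < s \<and> j < t}"

definition Jz :: "complex \<Rightarrow> nat \<Rightarrow> (nat \<times> nat) quadratic_algebra" where
  "Jz q n = (Jz_generators n, tensor2.span (Jz_relations q n))"

definition Gamma_z ::
    "complex \<Rightarrow> nat \<Rightarrow> ((nat \<times> nat \<Rightarrow> complex) set \<times> (nat \<times> nat \<Rightarrow> complex) set) set" where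
  "Gamma_z q n = associated_variety (Jz q n)"

text \<open>
  The entries of a \<open>complex mat\<close> are unspecified outside its dimensions, so they are cut
  off explicitly.
\<close>

definition mat_point :: "complex mat \<Rightarrow> (nat \<times> nat \<Rightarrow> complex) set" where
  "mat_point A =
     proj_class (\<lambda>(i, j). if i < dim_row A \<and> j < dim_col A then A $$ (i, j) else 0)"

abbreviation mat_rank :: "complex mat \<Rightarrow> nat" where
  "mat_rank A \<equiv> vec_space.rank (dim_row A) A"

text \<open>
  \<open>diag(0,\<dots>,0,D\<^sub>1,0,\<dots>,0,D\<^sub>2,0,\<dots>,0)\<close>; since D1 and D2 may be rectangular, each run of zeros
  is a zero block whose numbers of rows \<open>r\<close> and columns \<open>c\<close> are independent and possibly 0.
\<close>

definition two_block_diag ::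
    "nat \<times> nat \<Rightarrow> nat \<times> nat \<Rightarrow> nat \<times> nat \<Rightarrow> complex mat \<Rightarrow> complex mat \<Rightarrow> complex mat" where
  "two_block_diag = (\<lambda>(r0, c0) (r1, c1) (r2, c2) D1 D2.
     diag_block_mat [0\<^sub>m r0 c0, D1, 0\<^sub>m r1 c1, D2, 0\<^sub>m r2 c2])"

end

theory Submission
  imports Defs
begin

text \<open>
  Let \<open>a\<close> and \<open>b\<close> represent a point of the variety, and extend both by zero to all index pairs;
  the relations then hold without any bound on the indices.  Say that two positions commute if
  the second lies weakly to the south-west or north-east of the first; otherwise one is strictly
  north-west of the other.  The commuting relations say that the vectors \<open>(a\<^sub>i\<^sub>j, b\<^sub>i\<^sub>j)\<close> at
  commuting positions are parallel.  Together with the other relations and \<open>q\<^sup>2 \<noteq> 0\<close>,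
  \<open>q\<^sup>2 \<noteq> 1\<close> this forces \<open>a\<close> and \<open>b\<close> to have the same support (\<open>b_zero_if_a_zero\<close>,
  \<open>a_zero_if_b_zero\<close>), so everything is encoded in \<open>a\<close> and the ratios \<open>b\<^sub>i\<^sub>j / a\<^sub>i\<^sub>j\<close> on the
  support.

  Each 2 by 2 minor of \<open>a\<close> either vanishes, or its antidiagonal is zero and the ratio in its
  upper left corner is \<open>q\<^sup>2\<close> times the one in its lower right corner (\<open>minor_cases\<close>).  In
  particular \<open>a\<close> has rank one on every rectangle on which the ratio is constant.  If it is
  constant everywhere, \<open>b\<close> is proportional to \<open>a\<close>: this is the first alternative.

  Otherwise, positions with different ratios are strictly ordered from north-west to south-east
  and the ratio is divided by \<open>q\<^sup>2\<close> along the way (\<open>ratio_neq_ordered\<close>).  A third ratio cannot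
  occur, as among three positions with distinct ratios the outer two would differ both by
  \<open>q\<^sup>4\<close> and by \<open>q\<^sup>2\<close>.  So there are two classes of positions, and every position of the first
  is north-west of every position of the second.  Only when \<open>q\<^sup>4 = 1\<close> could the two classes
  interleave as far as the ratios are concerned, and \<open>ratio_between\<close> rules this out.  Cutting
  after the last row and the last column that meet the first class gives the second alternative
  (\<open>two_blocks\<close>).  These two blocks fill the whole matrix, so the three zero blocks are taken
  to be empty; zero rows and columns are absorbed into the blocks of rank one.
\<close>

section \<open>Matrices of rank one\<close>

text \<open>
  A column through a nonzero entry is a maximal independent set of columns, since the vanishing
  minors make every column a multiple of it.
\<close>

lemma (in vec_space) rank_one_if_minors_vanish:
  assumes A: "A \<in> carrier_mat n nc"
    and nz: "k < n" "l < nc" "A $$ (k, l) \<noteq> 0"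
    and minors: "\<And>i s j t. \<lbrakk>i < n; s < n; j < nc; t < nc\<rbrakk>
      \<Longrightarrow> A $$ (i, j) * A $$ (s, t) = A $$ (i, t) * A $$ (s, j)"
  shows "rank A = 1"
proof -
  define v where "v = col A l"
  have v: "v \<in> carrier_vec n" using A by (auto simp: v_def)
  have "v $ k \<noteq> 0" using A nz by (simp add: v_def)
  then have "v \<noteq> 0\<^sub>v n" using nz by auto
  then have indep: "lin_indpt {v}"
    using lin_dep_iff_in_span[of "{}" v] v finite_lin_indpt2[of "{}"]
    by (auto simp: span_empty)
  have in_span: "w \<in> span {v}" if w: "w \<in> set (cols A)" for w
  proof -
    obtain j where j: "j < nc" "w = col A j"
      using w A by (auto simp: cols_def)
    have "w = (A $$ (k, j) / A $$ (k, l)) \<cdot>\<^sub>v v"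
      using j A nz minors[of _ k j l]
      by (intro eq_vecI) (auto simp: v_def field_simps)
    moreover have "v \<in> span {v}" using v span_mem[of "{v}" v] by simp
    ultimately show ?thesis using v by (metis empty_subsetI insert_subset smult_in_span)
  qed
  have "maximal {v} (\<lambda>T. T \<subseteq> set (cols A) \<and> lin_indpt T)"
    unfolding maximal_def
  proof (intro conjI allI impI)
    show "{v} \<subseteq> set (cols A)" using A nz by (auto simp: v_def cols_def)
    show "lin_indpt {v}" by (fact indep)
    fix T assume T: "{v} \<subseteq> T \<and> T \<subseteq> set (cols A) \<and> lin_indpt T"
    show "T = {v}"
    proof (rule ccontr)
      assume "T \<noteq> {v}"
      then obtain w where w: "w \<in> T" "w \<noteq> v" using T by auto
      have "lin_indpt {v, w}"
        using T w subset_li_is_li[of T "{v, w}"] by auto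
      moreover have "lin_dep {v, w}"
        using lin_dep_iff_in_span[of "{v}" w] in_span[of w] w T v indep cols_dim[of A] A
        by (auto simp: insert_commute)
      ultimately show False by simp
    qed
  qed
  then show ?thesis using rank_card_indpt[OF A] by force
qed

section \<open>Zeros of the relations\<close>

text \<open>
  Here \<open>Q\<close> stands for \<open>q\<^sup>2\<close>: the second family of relations is multiplied by \<open>q\<close>.  One inequality
  pattern suffices in \<open>commute\<close>, because the relation is symmetric in the two positions.
\<close>

locale Jz_zero_pair =
  fixes Q :: complex and n :: nat and a b :: "nat \<Rightarrow> nat \<Rightarrow> complex"
  assumes Q_nonzero: "Q \<noteq> 0" and Q_not_one: "Q \<noteq> 1"
    and commute: "\<lbrakk>i \<le> s; t \<le> j\<rbrakk> \<Longrightarrow> a i j * b s t = a s t * b i j"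
    and twisted: "\<lbrakk>i < s; j < t\<rbrakk>
      \<Longrightarrow> Q * a i j * b s t = a s t * b i j + (Q - 1) * a i t * b s j"
    and a_nonzero: "\<exists>i j. a i j \<noteq> 0" and b_nonzero: "\<exists>i j. b i j \<noteq> 0"
    and bounded: "a i j \<noteq> 0 \<Longrightarrow> i < n \<and> j < n"
begin

lemma position_cases:
  fixes i j s t :: nat
  obtains "i \<le> s" "t \<le> j" | "s \<le> i" "j \<le> t" | "i < s" "j < t" | "s < i" "t < j"
  by (cases i s rule: linorder_cases; cases j t rule: linorder_cases) (use that in auto)

text \<open>
  If \<open>b\<close> were nonzero at a zero of \<open>a\<close>, the commuting relations would clear the row and the
  column of \<open>a\<close> through this position.  The mixed term of the other relations then drops out
  and they make all remaining entries of \<open>a\<close> zero.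
\<close>

lemma b_zero_if_a_zero:
  assumes "a i j = 0"
  shows "b i j = 0"
proof (rule ccontr)
  assume b: "b i j \<noteq> 0"
  obtain s t where st: "a s t \<noteq> 0" using a_nonzero by blast
  show False
  proof (cases i s t j rule: position_cases)
    case 1 then show False using commute[of i s t j] st b assms by simp
  next
    case 2 then show False using commute[of s i j t] st b assms by simp
  next
    case 3
    then have "a i t = 0" using commute[of i i j t] b assms by simp
    then show False using twisted[OF 3] st b assms by simp
  next
    case 4
    then have "a s j = 0" using commute[of s i j j] b assms by simp
    then show False using twisted[OF 4] st b assms Q_nonzero by simp
  qed
qed

lemma a_zero_if_b_zero:
  assumes "b i j = 0"
  shows "a i j = 0"
proof (rule ccontr)
  assume a: "a i j \<noteq> 0"
  obtain s t where st: "b s t \<noteq> 0" using b_nonzero by blast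
  show False
  proof (cases i s t j rule: position_cases)
    case 1 then show False using commute[of i s t j] st a assms by simp
  next
    case 2 then show False using commute[of s i j t] st a assms by simp
  next
    case 3
    then have "b s j = 0" using commute[of i s j j] a assms by simp
    then show False using twisted[OF 3] st a assms Q_nonzero by simp
  next
    case 4
    then have "b i t = 0" using commute[of i i t j] a assms by simp
    then show False using twisted[OF 4] st a assms by simp
  qed
qed

definition ratio :: "nat \<Rightarrow> nat \<Rightarrow> complex" where
  "ratio i j = b i j / a i j"

lemma b_eq: "b i j = ratio i j * a i j"
  using b_zero_if_a_zero by (simp add: ratio_def)

lemma ratio_nonzero: "a i j \<noteq> 0 \<Longrightarrow> ratio i j \<noteq> 0"
  using a_zero_if_b_zero by (auto simp: ratio_def)

lemma ratio_eq_if_commute: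
  "\<lbrakk>i \<le> s; t \<le> j; a i j \<noteq> 0; a s t \<noteq> 0\<rbrakk> \<Longrightarrow> ratio i j = ratio s t"
  using commute[of i s t j] by (simp add: ratio_def field_simps)

text \<open>
  An entry in one of the off-diagonal corners commutes with the other three corners, so as soon
  as one is nonzero the ratios agree and the relation turns into a multiple of the minor.
\<close>

lemma minor_cases:
  assumes "i < s" "j < t"
  obtains (vanish) "a i j * a s t = a i t * a s j"
  | (corners) "a i t = 0" "a s j = 0" "ratio i j = Q * ratio s t"
proof (cases "a i t = 0 \<and> a s j = 0")
  case True
  then show thesis
    using twisted[OF assms] that by (cases "a i j * a s t = 0") (auto simp: b_eq)
next
  case False
  have tw: "a i j * a s t * (Q * ratio s t - ratio i j) = (Q - 1) * a i t * a s j * ratio s j"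
    using twisted[OF assms] by (simp add: b_eq algebra_simps)
  have "a i j * a s t = a i t * a s j"
  proof (cases "a i j = 0 \<or> a s t = 0")
    case True
    then show ?thesis using tw Q_not_one ratio_nonzero[of s j] by auto
  next
    case nz: False
    \<comment> \<open>The nonzero off-diagonal entry commutes with both diagonal ones.\<close>
    have eq: "ratio i j = ratio s t"
    proof (cases "a i t = 0")
      case True
      with False have "a s j \<noteq> 0" by simp
      then show ?thesis
        using ratio_eq_if_commute[of i s j j] ratio_eq_if_commute[of s s j t] assms nz by simp
    next
      case False
      then show ?thesis
        using ratio_eq_if_commute[of i i j t] ratio_eq_if_commute[of i s t t] assms nz by simp
    qed
    have "a s j \<noteq> 0"
      using tw eq nz Q_not_one ratio_nonzero[of s t] by (auto simp: algebra_simps)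
    then have "ratio s j = ratio s t"
      using ratio_eq_if_commute[of s s j t] assms nz by simp
    then have "(Q - 1) * ratio s t * (a i j * a s t - a i t * a s j) = 0"
      using tw eq by (simp add: algebra_simps)
    then show ?thesis using nz Q_not_one ratio_nonzero[of s t] by simp
  qed
  then show thesis by (rule vanish)
qed

lemma ratio_neq_ordered:
  assumes "a i j \<noteq> 0" "a s t \<noteq> 0" "ratio i j \<noteq> ratio s t"
  obtains "i < s" "j < t" "ratio i j = Q * ratio s t"
  | "s < i" "t < j" "ratio s t = Q * ratio i j"
proof -
  have *: "ratio i j = Q * ratio s t"
    if lt: "i < s" "j < t" and nz: "a i j \<noteq> 0" "a s t \<noteq> 0" and neq: "ratio i j \<noteq> ratio s t" for i j s t
    using lt
  proof (cases rule: minor_cases)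
    case vanish
    then have "a i t \<noteq> 0" using nz by auto
    then have False
      using ratio_eq_if_commute[of i i j t] ratio_eq_if_commute[of i s t t] lt nz neq by simp
    then show ?thesis ..
  qed
  show thesis
  proof (cases i s t j rule: position_cases)
    case 1 then show thesis using ratio_eq_if_commute[of i s t j] assms by simp
  next
    case 2 then show thesis using ratio_eq_if_commute[of s i j t] assms by simp
  next
    case 3 then show thesis using *[of i s j t] that(1) assms by blast
  next
    case 4 then show thesis using *[of s i t j] that(2) assms by metis
  qed
qed

text \<open>
  Equal ratios at the ends of a diagonal make the off-diagonal corner \<open>(i, t)\<close> nonzero, and this
  corner commutes with everything between the two ends.
\<close>

lemma ratio_between:
  assumes "i < k" "j < l" "k < s" "l < t"
    and nz: "a i j \<noteq> 0" "a k l \<noteq> 0" "a s t \<noteq> 0" and eq: "ratio i j = ratio s t"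
  shows "ratio k l = ratio s t"
proof -
  have lt: "i < s" "j < t" using assms by auto
  then have "a i t \<noteq> 0"
  proof (cases rule: minor_cases)
    case vanish then show ?thesis using nz by auto
  next
    case corners
    then show ?thesis using eq Q_not_one ratio_nonzero[of s t] nz by simp
  qed
  then show ?thesis
    using ratio_eq_if_commute[of i k l t] ratio_eq_if_commute[of i s t t] assms by auto
qed

text \<open>
  In a nonvanishing minor the diagonal corners would have ratios differing by the factor \<open>Q \<noteq> 1\<close>.
\<close>

lemma minors_vanish_if_ratio_const:
  assumes const: "\<And>i j. \<lbrakk>i \<in> I; j \<in> J; a i j \<noteq> 0\<rbrakk> \<Longrightarrow> ratio i j = c"
    and ix: "i \<in> I" "s \<in> I" "j \<in> J" "t \<in> J"
  shows "a i j * a s t = a i t * a s j"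
proof -
  have *: "a i j * a s t = a i t * a s j"
    if "i < s" "j < t" and ix: "i \<in> I" "s \<in> I" "j \<in> J" "t \<in> J" for i s j t
    using that(1,2)
  proof (cases rule: minor_cases)
    case corners
    have "a i j * a s t = 0"
    proof (rule ccontr)
      assume "a i j * a s t \<noteq> 0"
      then show False
        using corners(3) const[of i j] const[of s t] ix Q_not_one ratio_nonzero[of s t] by auto
    qed
    then show ?thesis using corners by simp
  qed
  consider "i = s" | "j = t" | "i < s" "j < t" | "i < s" "t < j" | "s < i" "j < t" | "s < i" "t < j"
    by linarith
  then show ?thesis
  proof cases
    case 3 then show ?thesis using *[of i s j t] ix by blast
  next
    case 4 then show ?thesis using *[of i s t j] ix by simp
  next
    case 5 then show ?thesis using *[of s i j t] ix by (metis mult.commute)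
  next
    case 6 then show ?thesis using *[of s i t j] ix by (metis mult.commute)
  qed (simp_all add: mult.commute)
qed

text \<open>
  The two given positions may be assumed to be in north-west to south-east order.  Their ratios
  are then the only ones that occur, and the cut is made just below and to the right of the
  positions that have the first ratio.
\<close>

lemma two_blocks:
  assumes u: "a i j \<noteq> 0" and v: "a s t \<noteq> 0" and neq: "ratio i j \<noteq> ratio s t"
  obtains r c \<mu> where "r \<le> n" "c \<le> n" "\<mu> \<noteq> 0"
    "\<forall>k l. a k l \<noteq> 0 \<longrightarrow> k < r \<and> l < c \<and> ratio k l = \<mu> \<or> r \<le> k \<and> c \<le> l \<and> ratio k l = \<mu> / Q"
    "\<exists>k l. a k l \<noteq> 0 \<and> k < r \<and> l < c" "\<exists>k l. a k l \<noteq> 0 \<and> r \<le> k \<and> c \<le> l"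
proof -
  \<comment> \<open>Rename the positions so that the first is the north-western one.\<close>
  obtain i j s t where u: "a i j \<noteq> 0" and v: "a s t \<noteq> 0" and neq: "ratio i j \<noteq> ratio s t"
    and lt: "i < s" "j < t" and Q: "ratio i j = Q * ratio s t"
  proof (rule ratio_neq_ordered[OF u v neq])
    assume "i < s" "j < t" "ratio i j = Q * ratio s t"
    then show ?thesis using that[of i j s t] u v neq by simp
  next
    assume "s < i" "t < j" "ratio s t = Q * ratio i j"
    then show ?thesis using that[of s t i j] u v neq by simp
  qed
  have two: "ratio k l = ratio i j \<or> ratio k l = ratio s t" if w: "a k l \<noteq> 0" for k l
  proof (rule ccontr)
    assume "\<not> ?thesis"
    then have n1: "ratio k l \<noteq> ratio i j" and n2: "ratio k l \<noteq> ratio s t" by auto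
    show False
    proof (rule ratio_neq_ordered[OF w u n1])
      assume wu: "k < i" "ratio k l = Q * ratio i j"
      show False
        by (rule ratio_neq_ordered[OF w v n2]) (use wu lt neq Q_nonzero in simp_all)
    next
      assume uw: "i < k" "ratio i j = Q * ratio k l"
      show False
        by (rule ratio_neq_ordered[OF w v n2]) (use uw Q n2 neq Q_nonzero in simp_all)
    qed
  qed
  have below: "k < k' \<and> l < l'"
    if w: "a k l \<noteq> 0" "ratio k l = ratio i j" and w': "a k' l' \<noteq> 0" "ratio k' l' = ratio s t"
    for k l k' l'
  proof -
    have n: "ratio k l \<noteq> ratio k' l'" "ratio i j \<noteq> ratio k' l'" using w w' neq by auto
    show ?thesis
    proof (rule ratio_neq_ordered[OF w(1) w'(1) n(1)])
      \<comment> \<open>In the wrong order, \<open>(k', l')\<close> lies between two positions with the first ratio, or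
        \<open>(i, j)\<close> lies between two positions with the second one.\<close>
      assume rev: "k' < k" "l' < l"
      show ?thesis
      proof (rule ratio_neq_ordered[OF u w'(1) n(2)])
        assume "i < k'" "j < l'"
        then show ?thesis using ratio_between[of i k' j l' k l] rev u w w' n by auto
      next
        assume "k' < i" "l' < j"
        then show ?thesis using ratio_between[of k' i l' j s t] lt u v w' neq by auto
      qed
    qed auto
  qed
  define S where "S = {(k, l). a k l \<noteq> 0 \<and> ratio k l = ratio i j}"
  have "S \<subseteq> {..<n} \<times> {..<n}" using bounded by (auto simp: S_def)
  then have fin: "finite S" by (rule finite_subset) simp
  have ij: "(i, j) \<in> S" using u by (simp add: S_def)
  define r where "r = Suc (Max (fst ` S))"
  define c where "c = Suc (Max (snd ` S))"
  have r_in: "r - 1 \<in> fst ` S" and c_in: "c - 1 \<in> snd ` S"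
    using Max_in[of "fst ` S"] Max_in[of "snd ` S"] fin ij unfolding r_def c_def
    by (simp_all only: diff_Suc_1 finite_imageI image_is_empty) blast+
  have inside: "k < r \<and> l < c" if "(k, l) \<in> S" for k l
    unfolding r_def c_def less_Suc_eq_le using that fin
    by (auto intro!: Max_ge simp: image_iff Bex_def)
  have outside: "r \<le> k \<and> c \<le> l" if kl: "a k l \<noteq> 0" "ratio k l = ratio s t" for k l
  proof -
    \<comment> \<open>The last row and the last column may be attained at different positions.\<close>
    obtain l1 where l1: "(r - 1, l1) \<in> S" using r_in by force
    obtain k1 where k1: "(k1, c - 1) \<in> S" using c_in by force
    have "r - 1 < k" using below[OF _ _ kl] l1 by (auto simp: S_def)
    moreover have "c - 1 < l" using below[OF _ _ kl] k1 by (auto simp: S_def)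
    ultimately show ?thesis by linarith
  qed
  show thesis
  proof (rule that[of r c "ratio i j"])
    show "r \<le> n" "c \<le> n" using outside[OF v] bounded[OF v] by auto
    show "ratio i j \<noteq> 0" using ratio_nonzero u by simp
    show "\<exists>k l. a k l \<noteq> 0 \<and> k < r \<and> l < c" using inside[OF ij] u by blast
    show "\<exists>k l. a k l \<noteq> 0 \<and> r \<le> k \<and> c \<le> l" using outside[OF v] v by blast
    show "\<forall>k l. a k l \<noteq> 0 \<longrightarrow> k < r \<and> l < c \<and> ratio k l = ratio i j
        \<or> r \<le> k \<and> c \<le> l \<and> ratio k l = ratio i j / Q"
      using two inside outside Q Q_nonzero by (fastforce simp: S_def)
  qed
qed

end

section \<open>From the associated variety to zeros of the relations\<close>

text \<open>
  Summing over a common finite superset of the supports makes evaluation visibly linear.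
\<close>

lemma tensor_eval_eq_sum:
  assumes "finite K" "Poly_Mapping.keys f \<subseteq> K"
  shows "tensor_eval f p p' = (\<Sum>(k, l)\<in>K. Poly_Mapping.lookup f (k, l) * p k * p' l)"
  unfolding tensor_eval_def
  by (rule sum.mono_neutral_left) (use assms in \<open>auto simp: in_keys_iff\<close>)

lemma tensor_eval_diff: "tensor_eval (f - g) p p' = tensor_eval f p p' - tensor_eval g p p'"
proof -
  let ?K = "Poly_Mapping.keys f \<union> Poly_Mapping.keys g"
  have "Poly_Mapping.keys (f - g) \<subseteq> ?K" by (auto simp: in_keys_iff lookup_minus)
  then show ?thesis
    by (simp add: tensor_eval_eq_sum[of ?K] lookup_minus left_diff_distrib sum_subtractf
        case_prod_unfold)
qed

lemma tensor_eval_add: "tensor_eval (f + g) p p' = tensor_eval f p p' + tensor_eval g p p'"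
proof -
  let ?K = "Poly_Mapping.keys f \<union> Poly_Mapping.keys g"
  have "Poly_Mapping.keys (f + g) \<subseteq> ?K" by (auto simp: in_keys_iff lookup_add)
  then show ?thesis
    by (simp add: tensor_eval_eq_sum[of ?K] lookup_add distrib_right sum.distrib case_prod_unfold)
qed

lemma tensor_eval_tscale: "tensor_eval (tscale c f) p p' = c * tensor_eval f p p'"
proof -
  have "Poly_Mapping.keys (tscale c f) \<subseteq> Poly_Mapping.keys f" by (auto simp: in_keys_iff)
  then show ?thesis
    by (simp add: tensor_eval_eq_sum[of "Poly_Mapping.keys f"] sum_distrib_left
        case_prod_unfold mult.assoc)
qed

lemma tensor_eval_tens: "tensor_eval (tens k l) p p' = p k * p' l"
  by (simp add: tensor_eval_def tens_def)

lemmas tensor_eval_simps =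
  tensor_eval_diff tensor_eval_add tensor_eval_tscale tensor_eval_tens

lemma proj_class_self: "p \<in> proj_class p"
  unfolding proj_class_def by (auto intro!: exI[of _ 1])

lemma proj_class_scale:
  assumes "c \<noteq> 0"
  shows "proj_class (\<lambda>k. c * p k) = proj_class p"
proof -
  have "\<exists>e. (\<lambda>k. d * p k) = (\<lambda>k. e * (c * p k)) \<and> e \<noteq> 0" if "d \<noteq> 0" for d
    by (rule exI[of _ "d / c"]) (use that assms in simp)
  moreover have "\<exists>e. (\<lambda>k. d * (c * p k)) = (\<lambda>k. e * p k) \<and> e \<noteq> 0" if "d \<noteq> 0" for d
    by (rule exI[of _ "d * c"]) (use that assms in \<open>simp add: mult.assoc\<close>)
  ultimately show ?thesis unfolding proj_class_def by auto
qed

text \<open>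
  Coordinates with an index outside the range vanish, and they make all products in the
  relations zero, which is why the bounds on the indices can be dropped.
\<close>

lemma Gamma_z_representatives:
  assumes q: "q \<noteq> 0" "q\<^sup>2 \<noteq> 1" and xy: "(x, y) \<in> Gamma_z q n"
  obtains p p' where "x = proj_class p" "y = proj_class p'"
    "p \<in> dual_space (Jz_generators n)"
    "Jz_zero_pair (q\<^sup>2) n (\<lambda>i j. p (i, j)) (\<lambda>i j. p' (i, j))"
proof -
  obtain p p' where x: "x = proj_class p" and y: "y = proj_class p'"
    and p: "p \<in> dual_space (Jz_generators n)" "p \<noteq> (\<lambda>k. 0)"
    and p': "p' \<in> dual_space (Jz_generators n)" "p' \<noteq> (\<lambda>k. 0)"
    using xy by (auto simp: Gamma_z_def associated_variety_def Jz_def proj_space_def)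
  have rel: "tensor_eval f p p' = 0" if "f \<in> Jz_relations q n" for f
    using xy tensor2.span_base[OF that] proj_class_self[of p] proj_class_self[of p']
    by (simp add: x y Gamma_z_def associated_variety_def Jz_def)
  have zero: "p (i, j) = 0 \<and> p' (i, j) = 0" if "n \<le> i \<or> n \<le> j" for i j
    using p p' that by (auto simp: dual_space_def Jz_generators_def)
  have "Jz_zero_pair (q\<^sup>2) n (\<lambda>i j. p (i, j)) (\<lambda>i j. p' (i, j))"
  proof
    show "q\<^sup>2 \<noteq> 0" "q\<^sup>2 \<noteq> 1" using q by auto
    show "\<exists>i j. p (i, j) \<noteq> 0" "\<exists>i j. p' (i, j) \<noteq> 0"
      using p p' by (auto simp: fun_eq_iff)
    show "i < n \<and> j < n" if "p (i, j) \<noteq> 0" for i j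
      using zero[of i j] that by (meson not_le)
    fix i j s t
    show "p (i, j) * p' (s, t) = p (s, t) * p' (i, j)" if le: "i \<le> s" "t \<le> j"
    proof (cases "i < n \<and> j < n \<and> s < n \<and> t < n")
      case True
      have "(int s - int i) * (int t - int j) \<le> 0"
        using le by (intro mult_nonneg_nonpos) auto
      then have "tens (i, j) (s, t) - tens (s, t) (i, j) \<in> Jz_relations q n"
        using True by (auto simp: Jz_relations_def)
      from rel[OF this] show ?thesis by (simp add: tensor_eval_simps)
    next
      case False
      then show ?thesis using zero[of i j] zero[of s t] by auto
    qed
    show "q\<^sup>2 * p (i, j) * p' (s, t)
        = p (s, t) * p' (i, j) + (q\<^sup>2 - 1) * p (i, t) * p' (s, j)"
      if lt: "i < s" "j < t"
    proof (cases "s < n \<and> t < n")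
      case True
      have "tscale q (tens (i, j) (s, t))
        - (tscale (inverse q) (tens (s, t) (i, j))
           + tscale (q - inverse q) (tens (i, t) (s, j))) \<in> Jz_relations q n"
        unfolding Jz_relations_def
        by (rule UnI2, rule CollectI, rule exI[of _ i], rule exI[of _ j], rule exI[of _ s],
            rule exI[of _ t]) (use True lt in simp)
      from rel[OF this]
      have rel': "q * (p (i, j) * p' (s, t)) = inverse q * (p (s, t) * p' (i, j))
          + (q - inverse q) * (p (i, t) * p' (s, j))"
        by (simp add: tensor_eval_simps)
      have "q\<^sup>2 * p (i, j) * p' (s, t) = q * (q * (p (i, j) * p' (s, t)))"
        by (simp add: power2_eq_square)
      also have "\<dots> = (q * inverse q) * (p (s, t) * p' (i, j))
          + (q * (q - inverse q)) * (p (i, t) * p' (s, j))"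
        unfolding rel' by (simp only: distrib_left mult.assoc)
      also have "q * (q - inverse q) = q\<^sup>2 - 1"
        using q by (simp add: right_diff_distrib power2_eq_square)
      finally show ?thesis using q by simp
    next
      case False
      then show ?thesis using zero[of s t] zero[of i t] zero[of s j] by auto
    qed
  qed
  then show thesis using that x y p by blast
qed

section \<open>The classification\<close>

lemma mat_point_mat:
  assumes "\<And>i j. n \<le> i \<or> n \<le> j \<Longrightarrow> p (i, j) = 0"
  shows "mat_point (mat n n p) = proj_class p"
proof -
  have "(\<lambda>(i, j). if i < n \<and> j < n then mat n n p $$ (i, j) else 0) = p"
    using assms by (auto simp: fun_eq_iff not_less)
  then show ?thesis by (simp add: mat_point_def)
qed

lemma two_block_diag_no_zero_blocks:
  assumes "r \<le> n" "c \<le> n"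
  shows "two_block_diag (0, 0) (0, 0) (0, 0) (mat r c f) (mat (n - r) (n - c) g) =
    mat n n (\<lambda>(i, j). if i < r \<and> j < c then f (i, j)
      else if r \<le> i \<and> c \<le> j then g (i - r, j - c) else 0)"
  using assms by (intro eq_matI) (auto simp: two_block_diag_def Let_def)

theorem theorem8p5:
  fixes q :: complex and n :: nat
    and x y :: "(nat \<times> nat \<Rightarrow> complex) set"
  assumes "q \<noteq> 0" and "q\<^sup>2 \<noteq> 1"
    and "(x, y) \<in> Gamma_z q n"
  shows "\<exists>a\<in>carrier_mat n n. \<exists>b\<in>carrier_mat n n.
    mat_point a = x \<and> mat_point b = y \<and>
    ((mat_rank a = 1 \<and> b = a) \<or>
     (\<exists>z0 z1 z2 D1 D2 T1 T2.
        mat_rank D1 = 1 \<and> mat_rank D2 = 1 \<and>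
        a = two_block_diag z0 z1 z2 D1 D2 \<and>
        b = two_block_diag z0 z1 z2 T1 T2 \<and>
        T1 = D1 \<and> T2 = inverse (q\<^sup>2) \<cdot>\<^sub>m D2))"
proof -
  obtain p p' where x: "x = proj_class p" and y: "y = proj_class p'"
    and p: "p \<in> dual_space (Jz_generators n)" and J: "Jz_zero_pair (q\<^sup>2) n (\<lambda>i j. p (i, j)) (\<lambda>i j. p' (i, j))"
    using Gamma_z_representatives[OF assms] .
  interpret Jz_zero_pair "q\<^sup>2" n "\<lambda>i j. p (i, j)" "\<lambda>i j. p' (i, j)" by (fact J)
  have zero: "p (i, j) = 0" if "n \<le> i \<or> n \<le> j" for i j
    using p that by (auto simp: dual_space_def Jz_generators_def)
  have px: "mat_point (mat n n p) = x" using mat_point_mat[of n p] zero x by simp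
  have y_scaled: "mat_point (mat n n g) = y"
    if "\<mu> \<noteq> 0" and g: "\<And>i j. p' (i, j) = \<mu> * g (i, j)" for \<mu> g
  proof -
    have "p' = (\<lambda>k. \<mu> * g k)" using g by (auto simp: fun_eq_iff)
    then have "y = proj_class g" using proj_class_scale[OF \<open>\<mu> \<noteq> 0\<close>, of g] y by simp
    moreover have "g (i, j) = 0" if "n \<le> i \<or> n \<le> j" for i j
      using zero[OF that] b_zero_if_a_zero[of i j] g[of i j] \<open>\<mu> \<noteq> 0\<close> by simp
    ultimately show ?thesis using mat_point_mat[of n g] by simp
  qed
  obtain i0 j0 where ij0: "p (i0, j0) \<noteq> 0" using a_nonzero by auto
  show ?thesis
  proof (cases "\<forall>i j. p (i, j) \<noteq> 0 \<longrightarrow> ratio i j = ratio i0 j0")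
    case True
    have "p (i, j) * p (s, t) = p (i, t) * p (s, j)" for i j s t
      using minors_vanish_if_ratio_const[of UNIV UNIV "ratio i0 j0" i s j t] True by auto
    then have "mat_rank (mat n n p) = 1"
      using vec_space.rank_one_if_minors_vanish[of "mat n n p" n n i0 j0] ij0 bounded[of i0 j0]
      by auto
    \<comment> \<open>The common ratio is the factor by which the second representative is rescaled.\<close>
    moreover have "mat_point (mat n n p) = y"
    proof (rule y_scaled[of "ratio i0 j0"])
      show "ratio i0 j0 \<noteq> 0" using ratio_nonzero ij0 by simp
      show "p' (i, j) = ratio i0 j0 * p (i, j)" for i j
        using b_eq[of i j] True by (cases "p (i, j) = 0") auto
    qed
    ultimately show ?thesis using px by (intro bexI[of _ "mat n n p"]) auto
  next
    case False
    then obtain i j where ij: "p (i, j) \<noteq> 0" "ratio i j \<noteq> ratio i0 j0" by blast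
    obtain r c \<mu> where rc: "r \<le> n" "c \<le> n" and \<mu>: "\<mu> \<noteq> 0"
      and blocks: "\<forall>k l. p (k, l) \<noteq> 0 \<longrightarrow>
        k < r \<and> l < c \<and> ratio k l = \<mu> \<or> r \<le> k \<and> c \<le> l \<and> ratio k l = \<mu> / q\<^sup>2"
      and first: "\<exists>k l. p (k, l) \<noteq> 0 \<and> k < r \<and> l < c"
      and second: "\<exists>k l. p (k, l) \<noteq> 0 \<and> r \<le> k \<and> c \<le> l"
      by (rule two_blocks[OF ij(1) ij0 ij(2)]) (rule that)
    define D1 where "D1 = mat r c p"
    define g where "g = (\<lambda>(i, j). p (i + r, j + c))"
    define D2 where "D2 = mat (n - r) (n - c) g"
    have T2: "inverse (q\<^sup>2) \<cdot>\<^sub>m D2 = mat (n - r) (n - c) (\<lambda>k. inverse (q\<^sup>2) * g k)"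
      by (auto simp: D2_def)
    define b where "b = two_block_diag (0, 0) (0, 0) (0, 0) D1 (inverse (q\<^sup>2) \<cdot>\<^sub>m D2)"
    have a: "mat n n p = two_block_diag (0, 0) (0, 0) (0, 0) D1 D2"
      unfolding D1_def D2_def two_block_diag_no_zero_blocks[OF rc]
      by (intro eq_matI) (use blocks in \<open>force simp: g_def\<close>)+
    have b: "b = mat n n (\<lambda>(i, j). if i < r \<and> j < c then p (i, j)
        else if r \<le> i \<and> c \<le> j then inverse (q\<^sup>2) * g (i - r, j - c) else 0)"
      unfolding b_def D1_def T2 two_block_diag_no_zero_blocks[OF rc] ..
    have py: "mat_point b = y"
      unfolding b
    proof (rule y_scaled[OF \<mu>])
      show "p' (i, j) = \<mu> * (case (i, j) of (i, j) \<Rightarrow> if i < r \<and> j < c then p (i, j)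
          else if r \<le> i \<and> c \<le> j then inverse (q\<^sup>2) * g (i - r, j - c) else 0)" for i j
        using blocks[rule_format, of i j] b_eq[of i j]
        by (cases "p (i, j) = 0") (auto simp: g_def field_simps)
    qed
    have rank1: "mat_rank D1 = 1"
    proof -
      obtain k l where "p (k, l) \<noteq> 0" "k < r" "l < c" using first by blast
      moreover have "p (i, j) * p (s, t) = p (i, t) * p (s, j)"
        if "i < r" "s < r" "j < c" "t < c" for i s j t
        using minors_vanish_if_ratio_const[of "{..<r}" "{..<c}" \<mu> i s j t] that blocks by force
      ultimately show ?thesis
        using vec_space.rank_one_if_minors_vanish[of D1 r c k l] by (auto simp: D1_def)
    qed
    have rank2: "mat_rank D2 = 1"
    proof -
      obtain k l where "p (k, l) \<noteq> 0" "r \<le> k" "c \<le> l" using second by blast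
      then have "g (k - r, l - c) \<noteq> 0" "k - r < n - r" "l - c < n - c"
        using bounded[of k l] by (auto simp: g_def)
      moreover have "g (i, j) * g (s, t) = g (i, t) * g (s, j)" for i s j t
        using minors_vanish_if_ratio_const[of "{r..}" "{c..}" "\<mu> / q\<^sup>2" "i + r" "s + r" "j + c" "t + c"]
          blocks by (force simp: g_def)
      ultimately show ?thesis
        using vec_space.rank_one_if_minors_vanish[of D2 "n - r" "n - c" "k - r" "l - c"]
        by (auto simp: D2_def)
    qed
    show ?thesis
    proof (intro bexI conjI disjI2 exI)
      show "mat_point (mat n n p) = x" by (fact px)
      show "mat_point b = y" by (fact py)
      show "mat_rank D1 = 1" by (fact rank1)
      show "mat_rank D2 = 1" by (fact rank2)
      show "mat n n p = two_block_diag (0, 0) (0, 0) (0, 0) D1 D2" by (fact a)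
      show "b = two_block_diag (0, 0) (0, 0) (0, 0) D1 (inverse (q\<^sup>2) \<cdot>\<^sub>m D2)"
        by (fact b_def)
      show "mat n n p \<in> carrier_mat n n" by simp
      show "b \<in> carrier_mat n n" by (simp add: b)
    qed (rule refl)+
  qed
qed

end
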